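(* For $c_1,c_2\in\mathbb{R}$ put $C(s,c_1,c_2)=\int_0^s\cos(c_1t+c_2t^2)\,dt$ and $S(s,c_1,c_2)=\int_0^s\sin(c_1t+c_2t^2)\,dt$. Up to reparametrisation, the immersed open or closed stationary solutions to the curve diffusion flow are precisely the members of the five-parameter family of curves, parametrised by arc length $s\in\mathbb{R}$, $$\gamma(s)=\left[\begin{pmatrix}\cos\theta&-\sin\theta\\ \sin\theta&\cos\theta\end{pmatrix}\begin{pmatrix}C(s,c_1,c_2)\\ S(s,c_1,c_2)\end{pmatrix}\right]^T+(V_1,V_2),\qquad (c_1,c_2,V_1,V_2,\theta)\in\mathbb{R}^4\times\mathbb{S}.$$
   Context: Curves are smooth regular plane curves, $s$ is arc length, $\nu$ a smooth unit normal field, and $\kappa=\langle\gamma_{ss},\nu\rangle$. The curve diffusion flow is $\langle \partial_t\gamma,\nu\rangle=-\kappa_{ss}$; a stationary solution is a curve with $\kappa_{ss}\equiv0$. A closed curve is one with $\gamma(u)=\gamma(u+P)$ for some $P>0$ (regarded as a periodic map on $\mathbb{R}$). An open curve is a regular immersion $\gamma:\mathbb{R}\to\mathbb{R}^2$, with arc length parameter ranging over all of $\mathbb{R}$, for which there is no pair of intervals $I,J\subset\mathbb{R}$ with $I\cap J=\emptyset$, $|I|=\infty$, $|J|<\infty$ and $\gamma(I)=\gamma(J)$. $\theta\in\mathbb{S}$ is regarded as an angle. *)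

theory Defs
  imports "HOL-Analysis.Analysis"
begin

definition smooth :: "(real \<Rightarrow> 'a::real_normed_vector) \<Rightarrow> bool" where
  "smooth f \<longleftrightarrow>
    (\<forall>n u. ((\<lambda>g v. vector_derivative g (at v)) ^^ n) f differentiable (at u))"

definition smooth_regular :: "(real \<Rightarrow> real^2) \<Rightarrow> bool" where
  "smooth_regular \<gamma> \<longleftrightarrow> smooth \<gamma> \<and> (\<forall>u. vector_derivative \<gamma> (at u) \<noteq> 0)"

definition unit_normal_field :: "(real \<Rightarrow> real^2) \<Rightarrow> (real \<Rightarrow> real^2) \<Rightarrow> bool" where
  "unit_normal_field \<gamma> \<nu> \<longleftrightarrow>
    smooth \<nu> \<and> (\<forall>u. norm (\<nu> u) = 1 \<and> \<nu> u \<bullet> vector_derivative \<gamma> (at u) = 0)"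

text \<open>The derivative of a quantity \<open>f\<close> along \<open>\<gamma>\<close> with respect to the arc length of \<open>\<gamma>\<close>,
  where both are given as functions of an arbitrary regular parameter.\<close>

definition arc_deriv ::
  "(real \<Rightarrow> real^2) \<Rightarrow> (real \<Rightarrow> 'a::real_normed_vector) \<Rightarrow> real \<Rightarrow> 'a" where
  "arc_deriv \<gamma> f u = vector_derivative f (at u) /\<^sub>R norm (vector_derivative \<gamma> (at u))"

definition curvature :: "(real \<Rightarrow> real^2) \<Rightarrow> (real \<Rightarrow> real^2) \<Rightarrow> real \<Rightarrow> real" where
  "curvature \<gamma> \<nu> u = arc_deriv \<gamma> (arc_deriv \<gamma> \<gamma>) u \<bullet> \<nu> u"

text \<open>A regular curve on the line has exactly two smooth unit normal fields, \<open>\<nu>\<close> and \<open>-\<nu>\<close>.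
  Replacing one by the other changes the sign of the curvature, so it does not matter
  which one is used here.\<close>

definition stationary :: "(real \<Rightarrow> real^2) \<Rightarrow> bool" where
  "stationary \<gamma> \<longleftrightarrow> smooth_regular \<gamma> \<and>
    (\<exists>\<nu>. unit_normal_field \<gamma> \<nu> \<and>
      (\<forall>u. arc_deriv \<gamma> (arc_deriv \<gamma> (curvature \<gamma> \<nu>)) u = 0))"

definition closed_curve :: "(real \<Rightarrow> real^2) \<Rightarrow> bool" where
  "closed_curve \<gamma> \<longleftrightarrow> smooth_regular \<gamma> \<and> (\<exists>P>0. \<forall>u. \<gamma> (u + P) = \<gamma> u)"

definition arc_length :: "(real \<Rightarrow> real^2) \<Rightarrow> real \<Rightarrow> real" where
  "arc_length \<gamma> u = (LBINT t=0..ereal u. norm (vector_derivative \<gamma> (at t)))"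

text \<open>The lengths of the intervals are measured in the given parameter. Since the arc length
  is an increasing bijection of the line here, an interval of parameters has infinite length
  exactly if the corresponding interval of arc lengths does.\<close>

definition open_curve :: "(real \<Rightarrow> real^2) \<Rightarrow> bool" where
  "open_curve \<gamma> \<longleftrightarrow> smooth_regular \<gamma> \<and> range (arc_length \<gamma>) = UNIV \<and>
    \<not> (\<exists>I J. is_interval I \<and> is_interval J \<and> I \<inter> J = {} \<and>
           emeasure lborel I = \<infinity> \<and> emeasure lborel J < \<infinity> \<and> \<gamma> ` I = \<gamma> ` J)"

definition reparametrisation :: "(real \<Rightarrow> real) \<Rightarrow> bool" where
  "reparametrisation \<phi> \<longleftrightarrow>
    bij \<phi> \<and> smooth \<phi> \<and> (\<forall>u. vector_derivative \<phi> (at u) \<noteq> 0)"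

definition fresnel_C :: "real \<Rightarrow> real \<Rightarrow> real \<Rightarrow> real" where
  "fresnel_C s c1 c2 = (LBINT t=0..ereal s. cos (c1 * t + c2 * t\<^sup>2))"

definition fresnel_S :: "real \<Rightarrow> real \<Rightarrow> real \<Rightarrow> real" where
  "fresnel_S s c1 c2 = (LBINT t=0..ereal s. sin (c1 * t + c2 * t\<^sup>2))"

text \<open>The angle is represented by a real number, of which only the class modulo
  \<open>2 * pi\<close> matters.\<close>

definition family_curve :: "real \<Rightarrow> real \<Rightarrow> real \<Rightarrow> real \<Rightarrow> real \<Rightarrow> real \<Rightarrow> real^2" where
  "family_curve c1 c2 V1 V2 \<theta> s =
    (vector [vector [cos \<theta>, - sin \<theta>], vector [sin \<theta>, cos \<theta>]] :: real^2^2)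
      *v vector [fresnel_C s c1 c2, fresnel_S s c1 c2] + vector [V1, V2]"

end

theory Submission
  imports Defs
begin

text \<open>If the curvature is affine in arc length, then the tangent angle is a quadratic polynomial of
  arc length, and integrating the tangent gives a member of the family; completeness makes arc
  length a bijection of the line. Conversely, the members with \<open>c\<^sub>2 = 0 \<noteq> c\<^sub>1\<close> are circles, and
  all others are injective, hence open: if \<open>0 \<le> a < b\<close> then the chord of \<open>\<integral> exp (i k t\<^sup>2) dt\<close> from
  \<open>a\<close> to \<open>b\<close> lies strictly to one side of the tangent at \<open>a\<close>, and the two halves of the spiral lie
  on different sides of the tangent at its inflection point.\<close>

section \<open>Smooth functions of one real variable\<close>

text \<open>Asking at each stage only for some derivative, instead of iterating
  \<open>vector_derivative\<close>, lets an induction use whichever derivative a calculus rule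
  supplies.\<close>

primrec differentiable_upto :: "nat \<Rightarrow> (real \<Rightarrow> 'a::real_normed_vector) \<Rightarrow> bool" where
  "differentiable_upto 0 f \<longleftrightarrow> True"
| "differentiable_upto (Suc n) f \<longleftrightarrow>
    (\<exists>f'. (\<forall>u. (f has_vector_derivative f' u) (at u)) \<and> differentiable_upto n f')"

lemma differentiable_upto_SucI:
  "(\<And>u. (f has_vector_derivative f' u) (at u)) \<Longrightarrow> differentiable_upto n f' \<Longrightarrow>
    differentiable_upto (Suc n) f"
  by auto

text \<open>Derivatives are unique, so each \<open>f'\<close> must be the
  \<open>vector_derivative\<close>; splitting off the derivative that is taken first gives an
  induction over all \<open>f\<close>.\<close>

lemma smooth_iff_differentiable_upto: "smooth f \<longleftrightarrow> (\<forall>n. differentiable_upto n f)"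
proof -
  let ?D = "\<lambda>g v. vector_derivative g (at v)"
  have "(\<forall>k<n. \<forall>u. (?D ^^ k) f differentiable (at u)) \<longleftrightarrow> differentiable_upto n f" for n
  proof (induction n arbitrary: f)
    case (Suc n)
    have "(\<forall>k<Suc n. \<forall>u. (?D ^^ k) f differentiable (at u)) \<longleftrightarrow>
      (\<forall>u. f differentiable (at u)) \<and> (\<forall>k<n. \<forall>u. (?D ^^ k) (?D f) differentiable (at u))"
      by (simp add: All_less_Suc2 funpow_Suc_right del: funpow.simps(2))
    also have "\<dots> \<longleftrightarrow> (\<forall>u. f differentiable (at u)) \<and> differentiable_upto n (?D f)"
      using Suc by blast
    also have "\<dots> \<longleftrightarrow> differentiable_upto (Suc n) f"
    proof
      assume "(\<forall>u. f differentiable (at u)) \<and> differentiable_upto n (?D f)"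
      then show "differentiable_upto (Suc n) f"
        by (auto simp: vector_derivative_works intro!: exI[of _ "?D f"])
    next
      assume "differentiable_upto (Suc n) f"
      then obtain f' where f': "\<forall>u. (f has_vector_derivative f' u) (at u)" "differentiable_upto n f'"
        by auto
      moreover from f' have "?D f = f'"
        by (auto intro!: ext vector_derivative_at)
      ultimately show "(\<forall>u. f differentiable (at u)) \<and> differentiable_upto n (?D f)"
        by (auto intro: differentiableI_vector)
    qed
    finally show ?case .
  qed auto
  then show ?thesis
    unfolding smooth_def by (metis lessI)
qed

lemma differentiable_upto_Suc_imp: "differentiable_upto (Suc n) f \<Longrightarrow> differentiable_upto n f"
proof (induction n arbitrary: f)
  case (Suc n)
  then show ?case by (meson differentiable_upto.simps(2))
qed simp

lemma differentiable_upto_add: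
  "differentiable_upto n f \<Longrightarrow> differentiable_upto n g \<Longrightarrow> differentiable_upto n (\<lambda>u. f u + g u)"
proof (induction n arbitrary: f g)
  case (Suc n)
  then obtain f' g' where
    "\<forall>u. (f has_vector_derivative f' u) (at u)" "differentiable_upto n f'"
    "\<forall>u. (g has_vector_derivative g' u) (at u)" "differentiable_upto n g'"
    by auto
  with Suc.IH[of f' g'] show ?case
    by (auto intro!: exI[of _ "\<lambda>u. f' u + g' u"] has_vector_derivative_add)
qed simp

text \<open>The product rule, for multiplication, scaling and the inner product at once. Each
  summand of the derivative pairs one original function with one derivative, so the originals are
  needed to order \<open>n\<close> as well.\<close>

lemma differentiable_upto_bilinear:
  assumes "bounded_bilinear h"
  shows "differentiable_upto n f \<Longrightarrow> differentiable_upto n g \<Longrightarrow>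
    differentiable_upto n (\<lambda>u. h (f u) (g u))"
proof (induction n arbitrary: f g)
  case (Suc n)
  then obtain f' g' where
    "\<forall>u. (f has_vector_derivative f' u) (at u)" "differentiable_upto n f'"
    "\<forall>u. (g has_vector_derivative g' u) (at u)" "differentiable_upto n g'"
    by auto
  moreover from Suc.prems have "differentiable_upto n f" "differentiable_upto n g"
    by (blast dest: differentiable_upto_Suc_imp)+
  ultimately show ?case
    using Suc.IH[of f g'] Suc.IH[of f' g]
    by (auto intro!: exI[of _ "\<lambda>u. h (f u) (g' u) + h (f' u) (g u)"] differentiable_upto_add
        bounded_bilinear.has_vector_derivative[OF assms])
qed simp

lemma differentiable_upto_const: "differentiable_upto n (\<lambda>u. c)"
proof (induction n arbitrary: c)
  case (Suc n)
  then show ?case by (auto intro!: exI[of _ "\<lambda>u. 0"])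
qed simp

text \<open>The derivative is a product of \<open>f'\<close> with copies of the inverse itself, so
  the induction hypothesis feeds its own step.\<close>

lemma differentiable_upto_inverse:
  fixes f :: "real \<Rightarrow> real"
  assumes "\<And>u. f u \<noteq> 0"
  shows "differentiable_upto n f \<Longrightarrow> differentiable_upto n (\<lambda>u. inverse (f u))"
proof (induction n)
  case (Suc n)
  then obtain f' where f': "\<forall>u. (f has_vector_derivative f' u) (at u)" "differentiable_upto n f'"
    by auto
  \<comment> \<open>The sign is written as a factor so that the rule for bilinear maps covers the
    whole derivative.\<close>
  have "((\<lambda>u. inverse (f u)) has_vector_derivative - 1 * (inverse (f u) * f' u * inverse (f u))) (at u)"
    for u
    using f'(1) assms DERIV_inverse'[of f "f' u" u UNIV]
    by (simp add: has_real_derivative_iff_has_vector_derivative)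
  moreover have "differentiable_upto n (\<lambda>u. - 1 * (inverse (f u) * f' u * inverse (f u)))"
    using Suc f'(2) differentiable_upto_Suc_imp
    by (intro differentiable_upto_bilinear[OF bounded_bilinear_mult] differentiable_upto_const) auto
  ultimately show ?case by (rule differentiable_upto_SucI)
qed simp

text \<open>The derivative is \<open>f \<bullet> f'\<close> over \<open>norm f\<close>, so the norm
  reappears only through its inverse and the induction closes.\<close>

lemma differentiable_upto_norm:
  fixes f :: "real \<Rightarrow> 'a::real_inner"
  assumes nz: "\<And>u. f u \<noteq> 0"
  shows "differentiable_upto n f \<Longrightarrow> differentiable_upto n (\<lambda>u. norm (f u))"
proof (induction n)
  case (Suc n)
  then obtain f' where f': "\<forall>u. (f has_vector_derivative f' u) (at u)" "differentiable_upto n f'"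
    by auto
  have "((\<lambda>u. norm (f u)) has_vector_derivative (f u \<bullet> f' u) * inverse (norm (f u))) (at u)" for u
  proof -
    have "((norm \<circ> f) has_derivative (\<lambda>h. h \<bullet> sgn (f u)) \<circ> (\<lambda>x. x *\<^sub>R f' u)) (at u)"
      using f'(1) has_derivative_norm[OF nz[of u]]
      by (intro diff_chain_at) (auto simp: has_vector_derivative_def)
    then show ?thesis
      by (simp add: has_vector_derivative_def o_def sgn_div_norm inner_commute mult.commute
          mult.left_commute divide_inverse)
  qed
  moreover have "differentiable_upto n (\<lambda>u. (f u \<bullet> f' u) * inverse (norm (f u)))"
    using Suc f'(2) differentiable_upto_Suc_imp nz
    by (intro differentiable_upto_bilinear[OF bounded_bilinear_mult]
        differentiable_upto_bilinear[OF bounded_bilinear_inner] differentiable_upto_inverse) auto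
  ultimately show ?case by (rule differentiable_upto_SucI)
qed simp

lemma smooth_bilinear:
  "bounded_bilinear h \<Longrightarrow> smooth f \<Longrightarrow> smooth g \<Longrightarrow> smooth (\<lambda>u. h (f u) (g u))"
  by (simp add: smooth_iff_differentiable_upto differentiable_upto_bilinear)

lemma smooth_inverse_norm:
  fixes f :: "real \<Rightarrow> 'a::real_inner"
  shows "smooth f \<Longrightarrow> (\<And>u. f u \<noteq> 0) \<Longrightarrow> smooth (\<lambda>u. inverse (norm (f u)))"
  by (simp add: smooth_iff_differentiable_upto differentiable_upto_inverse differentiable_upto_norm)

lemma smooth_norm:
  fixes f :: "real \<Rightarrow> 'a::real_inner"
  shows "smooth f \<Longrightarrow> (\<And>u. f u \<noteq> 0) \<Longrightarrow> smooth (\<lambda>u. norm (f u))"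
  by (simp add: smooth_iff_differentiable_upto differentiable_upto_norm)

lemma smooth_from_derivative:
  assumes "\<And>u. (f has_vector_derivative f' u) (at u)" "smooth f'"
  shows "smooth f"
  using assms
  by (metis smooth_iff_differentiable_upto differentiable_upto.simps not0_implies_Suc)

lemma smooth_const: "smooth (\<lambda>u. c)"
  by (simp add: smooth_iff_differentiable_upto differentiable_upto_const)

lemma smooth_has_vector_derivative:
  "smooth f \<Longrightarrow> (f has_vector_derivative vector_derivative f (at u)) (at u)"
  unfolding smooth_def using vector_derivative_works[of f "at u"] by (metis funpow_0)

lemma smooth_vector_derivative: "smooth f \<Longrightarrow> smooth (\<lambda>u. vector_derivative f (at u))"
  unfolding smooth_def
  by (metis (no_types, lifting) comp_apply funpow_Suc_right)

lemma smooth_continuous: "smooth f \<Longrightarrow> continuous_on A f"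
  by (meson continuous_at_imp_continuous_on has_vector_derivative_continuous
      smooth_has_vector_derivative)

lemma constant_if_derivative_zero:
  fixes f :: "real \<Rightarrow> 'a::real_normed_vector"
  assumes "\<And>u. (f has_vector_derivative 0) (at u)"
  shows "f u = f v"
  using has_vector_derivative_zero_constant[of UNIV f] assms
  by (metis UNIV_I convex_UNIV)

lemma has_vector_derivative_shift:
  assumes "(f has_vector_derivative f') (at (u + c))"
  shows "((\<lambda>u. f (u + c)) has_vector_derivative f') (at u)"
proof -
  have "((\<lambda>u. u + c) has_vector_derivative 1) (at u)"
    by (simp add: has_vector_derivative_add_const)
  from vector_diff_chain_at[OF this assms] show ?thesis
    by (simp add: o_def)
qed

section \<open>Unit vectors of the plane\<close>

definition direction :: "real \<Rightarrow> real^2" where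
  "direction a = vector [cos a, sin a]"

definition rot90 :: "real^2 \<Rightarrow> real^2" where
  "rot90 v = vector [- (v $ 2), v $ 1]"

lemma direction_nth [simp]: "direction a $ 1 = cos a" "direction a $ 2 = sin a"
  by (auto simp: direction_def)

lemma rot90_nth [simp]: "rot90 v $ 1 = - (v $ 2)" "rot90 v $ 2 = v $ 1"
  by (auto simp: rot90_def)

lemma inner_plane: "(v :: real^2) \<bullet> w = v $ 1 * w $ 1 + v $ 2 * w $ 2"
  by (simp add: inner_vec_def sum_2)

lemma norm_direction [simp]: "norm (direction a) = 1"
  by (simp add: norm_eq_1 inner_plane flip: power2_eq_square)

lemma direction_add_right_angle: "direction (a + pi / 2) = rot90 (direction a)"
  by (simp add: vec_eq_iff forall_2 cos_add sin_add)

lemma rot90_diff: "rot90 (v - w) = rot90 v - rot90 w"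
  by (simp add: vec_eq_iff forall_2)

lemma inner_rot90_self [simp]: "rot90 v \<bullet> v = 0"
  by (simp add: inner_plane)

lemma bounded_linear_rot90: "bounded_linear rot90"
  by (intro linear_conv_bounded_linear[THEN iffD1] linearI) (auto simp: vec_eq_iff forall_2)

text \<open>\<open>v\<close> and \<open>rot90 v\<close> form an orthonormal basis, and the
  coefficient along \<open>v\<close> vanishes.\<close>

lemma orthogonal_to_unit_vector:
  fixes v w :: "real^2"
  assumes "norm v = 1" "w \<bullet> v = 0"
  shows "w = (w \<bullet> rot90 v) *\<^sub>R rot90 v"
proof -
  have v: "v $ 1 * v $ 1 + v $ 2 * v $ 2 = 1" and w: "w $ 1 * v $ 1 + w $ 2 * v $ 2 = 0"
    using assms by (simp_all add: norm_eq_1 inner_plane)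
  have "w $ 1 = (w $ 2 * v $ 1 - w $ 1 * v $ 2) * - v $ 2"
    using v w by algebra
  moreover have "w $ 2 = (w $ 2 * v $ 1 - w $ 1 * v $ 2) * v $ 1"
    using v w by algebra
  ultimately show ?thesis
    by (simp add: vec_eq_iff forall_2 inner_plane algebra_simps)
qed

lemma unit_vector_direction:
  assumes "norm (v :: real^2) = 1"
  obtains a where "v = direction a"
proof -
  have "(v $ 1)\<^sup>2 + (v $ 2)\<^sup>2 = 1"
    using assms by (simp add: norm_eq_1 inner_plane power2_eq_square)
  then show ?thesis
    using that by (elim sincos_total_2pi) (auto simp: vec_eq_iff forall_2)
qed

lemma direction_conv: "direction a = cos a *\<^sub>R axis 1 1 + sin a *\<^sub>R axis 2 1"
  by (simp add: vec_eq_iff forall_2 axis_def)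

lemma has_vector_derivative_direction:
  assumes "(f has_vector_derivative f') (at u)"
  shows "((\<lambda>u. direction (f u)) has_vector_derivative f' *\<^sub>R rot90 (direction (f u))) (at u)"
proof -
  have "(f has_real_derivative f') (at u)"
    using assms by (simp add: has_real_derivative_iff_has_vector_derivative)
  then have "((\<lambda>u. cos (f u) *\<^sub>R axis 1 1 + sin (f u) *\<^sub>R axis 2 1 :: real^2) has_vector_derivative
      (- sin (f u) * f') *\<^sub>R axis 1 1 + (cos (f u) * f') *\<^sub>R axis 2 1) (at u)"
    by (auto intro!: derivative_eq_intros)
  moreover have "(- sin (f u) * f') *\<^sub>R axis 1 1 + (cos (f u) * f') *\<^sub>R axis 2 1 =
      f' *\<^sub>R rot90 (direction (f u))"
    by (simp add: vec_eq_iff forall_2 axis_def)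
  ultimately show ?thesis by (simp add: direction_conv[symmetric])
qed

text \<open>Differentiation turns the angle by \<open>pi / 2\<close>, so the derivative is a scalar
  multiple of \<open>direction\<close> of another smooth angle; hence the induction runs over all
  \<open>f\<close>.\<close>

lemma smooth_direction:
  assumes "smooth f"
  shows "smooth (\<lambda>u. direction (f u))"
proof -
  have "differentiable_upto n (\<lambda>u. direction (f u))" if "smooth f" for n f
    using that
  proof (induction n arbitrary: f)
    case (Suc n)
    let ?f' = "\<lambda>u. vector_derivative f (at u)"
    have "smooth (\<lambda>u. f u + pi / 2)"
      using Suc.prems smooth_const
      by (auto simp: smooth_iff_differentiable_upto intro!: differentiable_upto_add)
    then have "differentiable_upto n (\<lambda>u. ?f' u *\<^sub>R direction (f u + pi / 2))"
      using Suc smooth_vector_derivative[of f]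
      by (auto simp: smooth_iff_differentiable_upto
          intro!: differentiable_upto_bilinear[OF bounded_bilinear_scaleR])
    with Suc.prems show ?case
      by (auto simp: direction_add_right_angle
          intro!: exI has_vector_derivative_direction smooth_has_vector_derivative)
  qed simp
  with assms show ?thesis
    by (simp add: smooth_iff_differentiable_upto)
qed

section \<open>The family\<close>

lemma has_vector_derivative_integral_from_0:
  fixes f :: "real \<Rightarrow> real"
  assumes "continuous_on UNIV f"
  shows "((\<lambda>u. LBINT t=0..ereal u. f t) has_vector_derivative f u) (at u)"
proof -
  \<comment> \<open>The fundamental theorem is applied on \<open>{-r..r}\<close>; this radius puts 0
    inside and \<open>u\<close> in the interior, where the restricted derivative is the full
    one.\<close>
  define r where "r = \<bar>u\<bar> + 1"
  have "((\<lambda>u. LBINT t=ereal 0..ereal u. f t) has_vector_derivative f u) (at u within {-r..r})"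
    by (rule interval_integral_FTC2) (auto simp: r_def intro: continuous_on_subset[OF assms])
  moreover have "at u within {-r..r} = at u"
    by (rule at_within_Icc_at) (auto simp: r_def)
  ultimately show ?thesis by (simp add: zero_ereal_def)
qed

text \<open>The columns of the rotation matrix are \<open>direction \<theta>\<close> and its quarter
  turn; in this frame differentiation acts on the two Fresnel integrals alone.\<close>

lemma family_curve_conv:
  "family_curve c1 c2 V1 V2 \<theta> s =
    fresnel_C s c1 c2 *\<^sub>R direction \<theta> + fresnel_S s c1 c2 *\<^sub>R rot90 (direction \<theta>) + vector [V1, V2]"
  by (simp add: family_curve_def vec_eq_iff forall_2 matrix_vector_mult_def sum_2 mult.commute)

lemma family_curve_0 [simp]: "family_curve c1 c2 V1 V2 \<theta> 0 = vector [V1, V2]"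
  by (simp add: family_curve_conv fresnel_C_def fresnel_S_def zero_ereal_def)

text \<open>By the addition formulas the rotation adds \<open>\<theta>\<close> to the tangent angle.
  The tangent is a unit vector, so the parameter is arc length.\<close>

lemma has_vector_derivative_family_curve:
  "(family_curve c1 c2 V1 V2 \<theta> has_vector_derivative direction (c1 * s + c2 * s\<^sup>2 + \<theta>)) (at s)"
proof -
  have C: "((\<lambda>s. fresnel_C s c1 c2) has_vector_derivative cos (c1 * s + c2 * s\<^sup>2)) (at s)"
    unfolding fresnel_C_def by (intro has_vector_derivative_integral_from_0 continuous_intros)
  have S: "((\<lambda>s. fresnel_S s c1 c2) has_vector_derivative sin (c1 * s + c2 * s\<^sup>2)) (at s)"
    unfolding fresnel_S_def by (intro has_vector_derivative_integral_from_0 continuous_intros)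
  have "((\<lambda>s. fresnel_C s c1 c2 *\<^sub>R direction \<theta> + fresnel_S s c1 c2 *\<^sub>R rot90 (direction \<theta>) +
      vector [V1, V2]) has_vector_derivative
      cos (c1 * s + c2 * s\<^sup>2) *\<^sub>R direction \<theta> + sin (c1 * s + c2 * s\<^sup>2) *\<^sub>R rot90 (direction \<theta>)) (at s)"
    using C S by (auto intro!: derivative_eq_intros
        simp: has_real_derivative_iff_has_vector_derivative)
  moreover have "cos (c1 * s + c2 * s\<^sup>2) *\<^sub>R direction \<theta> + sin (c1 * s + c2 * s\<^sup>2) *\<^sub>R rot90 (direction \<theta>) =
      direction (c1 * s + c2 * s\<^sup>2 + \<theta>)"
    by (simp add: vec_eq_iff forall_2 cos_add sin_add)
  ultimately show ?thesis by (simp add: family_curve_conv[abs_def])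
qed

lemma vector_derivative_family_curve:
  "vector_derivative (family_curve c1 c2 V1 V2 \<theta>) (at s) = direction (c1 * s + c2 * s\<^sup>2 + \<theta>)"
  by (intro vector_derivative_at has_vector_derivative_family_curve)

lemma has_vector_derivative_phase:
  "((\<lambda>s. c1 * s + c2 * s\<^sup>2 + \<theta>) has_vector_derivative c1 + 2 * c2 * s) (at (s::real))"
  unfolding has_real_derivative_iff_has_vector_derivative[symmetric]
  by (auto intro!: derivative_eq_intros)

lemma has_vector_derivative_affine:
  "((\<lambda>s. c1 + 2 * c2 * s) has_vector_derivative 2 * c2) (at (s::real))"
  unfolding has_real_derivative_iff_has_vector_derivative[symmetric]
  by (auto intro!: derivative_eq_intros)

lemma smooth_phase: "smooth (\<lambda>s::real. c1 * s + c2 * s\<^sup>2 + \<theta>)"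
  by (rule smooth_from_derivative[OF has_vector_derivative_phase],
      rule smooth_from_derivative[OF has_vector_derivative_affine], rule smooth_const)

lemma smooth_regular_family_curve: "smooth_regular (family_curve c1 c2 V1 V2 \<theta>)"
proof -
  have "direction a \<noteq> 0" for a
    using norm_direction[of a] by force
  then show ?thesis
    unfolding smooth_regular_def vector_derivative_family_curve
    using smooth_from_derivative[OF has_vector_derivative_family_curve smooth_direction[OF smooth_phase]]
    by blast
qed

lemma arc_deriv_unit_speed:
  assumes "\<And>s. norm (vector_derivative \<gamma> (at s)) = 1"
    and "\<And>s. (f has_vector_derivative f' s) (at s)"
  shows "arc_deriv \<gamma> f = f'"
  using assms by (auto simp: arc_deriv_def fun_eq_iff vector_derivative_at)

text \<open>At unit speed the curvature is the derivative of the tangent angle, here the affine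
  function \<open>c1 + 2 * c2 * s\<close>, whose second derivative vanishes.\<close>

lemma stationary_family_curve: "stationary (family_curve c1 c2 V1 V2 \<theta>)"
proof -
  let ?\<gamma> = "family_curve c1 c2 V1 V2 \<theta>"
  define \<phi> where "\<phi> s = c1 * s + c2 * s\<^sup>2 + \<theta>" for s
  \<comment> \<open>The quarter turn of the tangent is written as a change of angle, so that its
    smoothness follows from that of the phase.\<close>
  define \<nu> where "\<nu> s = direction (\<phi> s + pi / 2)" for s
  have D: "vector_derivative ?\<gamma> (at s) = direction (\<phi> s)" for s
    by (simp add: vector_derivative_family_curve \<phi>_def)
  have \<nu>: "\<nu> s = rot90 (direction (\<phi> s))" for s
    by (simp add: \<nu>_def direction_add_right_angle)
  have unit: "norm (vector_derivative ?\<gamma> (at s)) = 1" for s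
    by (simp add: D)
  have "smooth \<nu>"
    unfolding \<nu>_def \<phi>_def using smooth_direction[OF smooth_phase[of c1 c2 "\<theta> + pi / 2"]]
    by (simp add: add.assoc)
  then have "unit_normal_field ?\<gamma> \<nu>"
    unfolding unit_normal_field_def D by (auto simp: \<nu>) (simp add: \<nu>[symmetric] \<nu>_def)
  moreover have "arc_deriv ?\<gamma> ?\<gamma> = (\<lambda>s. direction (\<phi> s))"
    unfolding \<phi>_def
    by (rule arc_deriv_unit_speed[OF unit has_vector_derivative_family_curve])
  moreover have "arc_deriv ?\<gamma> (\<lambda>s. direction (\<phi> s)) = (\<lambda>s. (c1 + 2 * c2 * s) *\<^sub>R rot90 (direction (\<phi> s)))"
    unfolding \<phi>_def
    by (rule arc_deriv_unit_speed[OF unit has_vector_derivative_direction[OF has_vector_derivative_phase]])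
  moreover have "rot90 (direction a) \<bullet> rot90 (direction a) = 1" for a
    by (simp add: inner_plane flip: power2_eq_square)
  ultimately have "curvature ?\<gamma> \<nu> s = c1 + 2 * c2 * s" for s
    by (simp add: curvature_def \<nu>)
  then have "curvature ?\<gamma> \<nu> = (\<lambda>s. c1 + 2 * c2 * s)" ..
  then have "arc_deriv ?\<gamma> (curvature ?\<gamma> \<nu>) = (\<lambda>s. 2 * c2)"
    using arc_deriv_unit_speed[OF unit has_vector_derivative_affine] by simp
  then have "arc_deriv ?\<gamma> (arc_deriv ?\<gamma> (curvature ?\<gamma> \<nu>)) = (\<lambda>s. 0)"
    using arc_deriv_unit_speed[OF unit has_vector_derivative_const] by simp
  with \<open>unit_normal_field ?\<gamma> \<nu>\<close> show ?thesis
    unfolding stationary_def using smooth_regular_family_curve by metis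
qed

section \<open>Arc length, and criteria for open and closed curves\<close>

lemma has_vector_derivative_arc_length:
  assumes "smooth_regular \<gamma>"
  shows "(arc_length \<gamma> has_vector_derivative norm (vector_derivative \<gamma> (at u))) (at u)"
proof -
  have "continuous_on UNIV (\<lambda>t. norm (vector_derivative \<gamma> (at t)))"
    using assms
    by (intro continuous_on_norm smooth_continuous smooth_vector_derivative) (simp add: smooth_regular_def)
  from has_vector_derivative_integral_from_0[OF this] show ?thesis
    by (simp add: arc_length_def[abs_def])
qed

lemma arc_length_0 [simp]: "arc_length \<gamma> 0 = 0"
  by (simp add: arc_length_def zero_ereal_def)

text \<open>Unit speed makes \<open>arc_length\<close> the identity. Under an injective map equal
  images force \<open>I = J\<close>; being disjoint they would be empty, against the infinite length
  of \<open>I\<close>.\<close>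

lemma open_curve_if_injective:
  assumes reg: "smooth_regular \<gamma>" and unit: "\<And>s. norm (vector_derivative \<gamma> (at s)) = 1"
    and inj: "inj \<gamma>"
  shows "open_curve \<gamma>"
proof -
  have "((\<lambda>s. arc_length \<gamma> s - s) has_vector_derivative 0) (at s)" for s
    using has_vector_derivative_diff[OF has_vector_derivative_arc_length[OF reg] has_vector_derivative_id, of s]
    by (simp add: unit)
  then have "arc_length \<gamma> s = s" for s
    using constant_if_derivative_zero[of "\<lambda>s. arc_length \<gamma> s - s" s 0] by simp
  then have "range (arc_length \<gamma>) = UNIV" by simp
  moreover have "\<not> (I \<inter> J = {} \<and> emeasure lborel I = \<infinity> \<and> \<gamma> ` I = \<gamma> ` J)" for I J
    using inj inj_image_eq_iff[of \<gamma> I J] by fastforce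
  ultimately show ?thesis
    unfolding open_curve_def using reg by blast
qed

text \<open>Constant nonzero curvature gives a circle: the curve is a fixed centre plus a uniformly
  turning radius vector, and inherits the period of that vector.\<close>

lemma closed_curve_family_curve:
  assumes "c1 \<noteq> 0"
  shows "closed_curve (family_curve c1 0 V1 V2 \<theta>)"
proof -
  let ?\<gamma> = "family_curve c1 0 V1 V2 \<theta>"
  \<comment> \<open>The centre of the circle: the subtracted vector is a primitive of the tangent.
    The zero quadratic term stays so that the lemmas on the phase apply with
    \<open>c2 = 0\<close>.\<close>
  define g where "g s = ?\<gamma> s - (1 / c1) *\<^sub>R direction (c1 * s + 0 * s\<^sup>2 + (\<theta> - pi / 2))" for s
  have rot: "rot90 (direction (c1 * s + 0 * s\<^sup>2 + (\<theta> - pi / 2))) = direction (c1 * s + 0 * s\<^sup>2 + \<theta>)" for s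
    by (simp flip: direction_add_right_angle)
  have "(g has_vector_derivative 0) (at s)" for s
  proof -
    have "(g has_vector_derivative direction (c1 * s + 0 * s\<^sup>2 + \<theta>) -
        (1 / c1) *\<^sub>R ((c1 + 2 * 0 * s) *\<^sub>R rot90 (direction (c1 * s + 0 * s\<^sup>2 + (\<theta> - pi / 2))))) (at s)"
      unfolding g_def
      by (intro has_vector_derivative_diff has_vector_derivative_family_curve
          bounded_linear.has_vector_derivative[OF bounded_linear_scaleR_right]
          has_vector_derivative_direction has_vector_derivative_phase)
    then show ?thesis
      unfolding rot using assms by simp
  qed
  then have const: "g s = g t" for s t
    by (rule constant_if_derivative_zero)
  define P where "P = 2 * pi / \<bar>c1\<bar>"
  \<comment> \<open>Over the length \<open>P\<close> the angle changes by a full turn, in the sense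
    given by the sign of \<open>c1\<close>.\<close>
  have "c1 * (s + P) = c1 * s + 2 * pi \<or> c1 * (s + P) = c1 * s - 2 * pi" for s
    using assms by (auto simp: P_def abs_if field_simps)
  then have "direction (c1 * (s + P) + b) = direction (c1 * s + b)" for s b
  proof -
    consider "c1 * (s + P) + b = c1 * s + b + 2 * pi" | "c1 * s + b = c1 * (s + P) + b + 2 * pi"
      using \<open>\<And>s. c1 * (s + P) = c1 * s + 2 * pi \<or> c1 * (s + P) = c1 * s - 2 * pi\<close>[of s] by force
    then show ?thesis
      by cases (simp_all only: vec_eq_iff forall_2 direction_nth cos_periodic sin_periodic)
  qed
  then have "?\<gamma> (s + P) = ?\<gamma> s" for s
    using const[of "s + P" s] by (simp add: g_def)
  moreover have "P > 0" using assms by (simp add: P_def)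
  ultimately show ?thesis
    unfolding closed_curve_def using smooth_regular_family_curve by blast
qed


section \<open>Injectivity of lines and spirals\<close>

text \<open>Integration by parts turns the sign of an oscillating integral into that of a nonnegative
  one: up to the boundary term \<open>(1 - cos (k * (b\<^sup>2 - a\<^sup>2))) / (2 * b)\<close>, the integral of
  \<open>k * sin (k * (t\<^sup>2 - a\<^sup>2))\<close> over \<open>[a, b]\<close> is that of \<open>(1 - cos (k * (t\<^sup>2 - a\<^sup>2))) / (2 * t\<^sup>2)\<close>.\<close>

lemma sin_square_primitive_less:
  fixes F :: "real \<Rightarrow> real"
  assumes "k \<noteq> 0" "0 \<le> a" "a < b"
    and F: "\<And>t. (F has_real_derivative sin (k * (t\<^sup>2 - a\<^sup>2))) (at t)"
  shows "k * F a < k * F b"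
proof -
  \<comment> \<open>The boundary term with upper limit \<open>t\<close>. It vanishes at
    \<open>t = a\<close>, even for \<open>a = 0\<close>, since division by zero yields 0.\<close>
  define h where "h t = (1 - cos (k * (t\<^sup>2 - a\<^sup>2))) / (2 * t)" for t
  define H where "H t = k * F t - h t" for t
  have DH: "(H has_real_derivative (1 - cos (k * (t\<^sup>2 - a\<^sup>2))) / (2 * t\<^sup>2)) (at t)" if "t > 0" for t
    unfolding H_def h_def using that
    by (auto intro!: derivative_eq_intros F simp: field_simps power2_eq_square)
  \<comment> \<open>\<open>DH\<close> covers positive \<open>t\<close> only, so continuity at 0,
    which matters when \<open>a = 0\<close>, is checked separately.\<close>
  have "isCont H t" if "a \<le> t" for t
  proof (cases "t = 0")
    case True
    with that \<open>0 \<le> a\<close> have a: "a = 0" by simp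
    \<comment> \<open>This bound makes \<open>h\<close> tend to its value 0 at 0; it comes from
      \<open>1 - cos y \<le> \<bar>y\<bar>\<close> at \<open>y = k * x\<^sup>2\<close>.\<close>
    have "\<bar>h x\<bar> \<le> \<bar>k\<bar> * \<bar>x\<bar>" for x
    proof (cases "x = 0")
      case False
      have "1 - cos y \<le> \<bar>y\<bar>" for y :: real
      proof -
        have "1 - cos y = 2 * \<bar>sin (y / 2)\<bar> * \<bar>sin (y / 2)\<bar>"
          using cos_double_sin[of "y / 2"] by (simp add: power2_eq_square)
        also have "\<dots> \<le> 2 * \<bar>y / 2\<bar> * 1"
          using abs_sin_x_le_abs_x[of "y / 2"] by (intro mult_mono) auto
        finally show ?thesis by simp
      qed
      from this[of "k * x\<^sup>2"] have "\<bar>1 - cos (k * x\<^sup>2)\<bar> \<le> 2 * \<bar>k * x\<^sup>2\<bar>"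
        by simp
      also have "\<dots> = 2 * \<bar>x\<bar> * (\<bar>k\<bar> * \<bar>x\<bar>)"
        by (simp add: abs_mult power2_eq_square)
      finally have "\<bar>1 - cos (k * x\<^sup>2)\<bar> \<le> 2 * \<bar>x\<bar> * (\<bar>k\<bar> * \<bar>x\<bar>)" .
      with False show ?thesis
        by (simp add: h_def a abs_divide divide_le_eq mult.commute)
    qed (simp add: h_def)
    then have "(h \<longlongrightarrow> 0) (at 0)"
      by (intro Lim_null_comparison[of h "\<lambda>x. \<bar>k\<bar> * \<bar>x\<bar>"]) (auto intro!: tendsto_eq_intros)
    then have "isCont h 0"
      by (simp add: isCont_def h_def)
    moreover have "isCont F 0"
      using F by (rule DERIV_isCont)
    ultimately show ?thesis
      unfolding H_def True by (intro continuous_intros)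
  next
    case False
    with that \<open>0 \<le> a\<close> have "t > 0" by simp
    from DERIV_isCont[OF DH[OF this]] show ?thesis .
  qed
  then have cont: "continuous_on {a..c} H" for c
    by (auto intro!: continuous_at_imp_continuous_on)
  \<comment> \<open>Strictly between \<open>a\<close> and \<open>c\<close> the argument of the
    cosine is nonzero and below 1 in absolute value, so \<open>H\<close> increases strictly; beyond
    \<open>c\<close> the cosine may return to 1, and \<open>H\<close> is only known not to
    decrease.\<close>
  define c where "c = min b (sqrt (a\<^sup>2 + 1 / \<bar>k\<bar>))"
  have c: "a < c" "c \<le> b"
    using assms by (auto simp: c_def intro!: real_less_rsqrt)
  have "H a < H c"
  proof (rule DERIV_pos_imp_increasing_open[OF c(1) _ cont])
    fix t assume t: "a < t" "t < c"
    then have "t\<^sup>2 < a\<^sup>2 + 1 / \<bar>k\<bar>"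
      using \<open>0 \<le> a\<close> power_strict_mono[of t "sqrt (a\<^sup>2 + 1 / \<bar>k\<bar>)" 2] by (simp add: c_def)
    moreover have "a\<^sup>2 < t\<^sup>2"
      using t \<open>0 \<le> a\<close> by (intro power_strict_mono) auto
    ultimately have "0 < t\<^sup>2 - a\<^sup>2" "t\<^sup>2 - a\<^sup>2 < 1 / \<bar>k\<bar>"
      by auto
    then have "0 < \<bar>k\<bar> * \<bar>t\<^sup>2 - a\<^sup>2\<bar>" "\<bar>k\<bar> * \<bar>t\<^sup>2 - a\<^sup>2\<bar> < 1"
      using \<open>k \<noteq> 0\<close> by (auto simp: pos_less_divide_eq mult.commute)
    then have "0 < \<bar>k * (t\<^sup>2 - a\<^sup>2)\<bar>" "\<bar>k * (t\<^sup>2 - a\<^sup>2)\<bar> < 1"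
      unfolding abs_mult .
    then have "cos \<bar>k * (t\<^sup>2 - a\<^sup>2)\<bar> < cos 0"
      using pi_gt3 by (intro cos_monotone_0_pi) auto
    then have "cos (k * (t\<^sup>2 - a\<^sup>2)) < 1" by simp
    then show "\<exists>y. (H has_real_derivative y) (at t) \<and> y > 0"
      using DH[of t] t \<open>0 \<le> a\<close> by (intro exI conjI) auto
  qed
  also have "H c \<le> H b"
  proof (rule DERIV_nonneg_imp_nondecreasing[OF c(2)])
    fix t assume "c \<le> t"
    then have "t > 0" using c \<open>0 \<le> a\<close> by simp
    from DH[OF this] show "\<exists>y. (H has_real_derivative y) (at t) \<and> y \<ge> 0"
      by (intro exI conjI) auto
  qed
  also have "H b \<le> k * F b"
    using assms by (simp add: H_def h_def)
  finally show ?thesis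
    by (simp add: H_def h_def)
qed

text \<open>\<open>F\<close> plays the role of a coordinate normal to a tangent line of the spiral,
  and \<open>c\<close> selects that tangent: at the endpoint nearer to the inflection point 0, or at
  0 itself if it lies between. One \<open>c\<close> serves all primitives, so the projection can be
  chosen after it.\<close>

lemma sin_square_primitive_separates:
  fixes k :: real
  assumes "k \<noteq> 0" "a < b"
  shows "\<exists>c. \<forall>F. (\<forall>t. (F has_real_derivative sin (k * t\<^sup>2 - c)) (at t)) \<longrightarrow> F a \<noteq> F b"
proof -
  have right: "k * F x < k * F y"
    if "0 \<le> x" "x < y" "\<And>t. (F has_real_derivative sin (k * t\<^sup>2 - k * x\<^sup>2)) (at t)" for F x y
    using sin_square_primitive_less[OF \<open>k \<noteq> 0\<close> that(1,2), of F] that(3)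
    by (simp add: right_diff_distrib)
  have left: "k * F x < k * F y"
    if "y \<le> 0" "x < y" "\<And>t. (F has_real_derivative sin (k * t\<^sup>2 - k * y\<^sup>2)) (at t)" for F x y
  proof -
    \<comment> \<open>The phase is even, so the reflected function has the same derivative, and the
      interval moves to the nonnegative half-line.\<close>
    have "((\<lambda>t. - F (- t)) has_real_derivative sin (k * t\<^sup>2 - k * (- y)\<^sup>2)) (at t)" for t
      using DERIV_minus[OF DERIV_mirror[THEN iffD1, OF that(3)[of "- t"]]] by simp
    from right[OF _ _ this, of "- x"] that show ?thesis by simp
  qed
  consider "0 \<le> a" | "b \<le> 0" | "a < 0" "0 < b" by linarith
  then show ?thesis
  proof cases
    case 1
    with right[OF 1 \<open>a < b\<close>] show ?thesis by (metis less_irrefl)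
  next
    case 2
    with left[OF 2 \<open>a < b\<close>] show ?thesis by (metis less_irrefl)
  next
    case 3
    \<comment> \<open>With \<open>c = 0\<close> the tangent at the inflection point is used, and
      \<open>k * F\<close> increases across both halves.\<close>
    have "F a \<noteq> F b" if "\<forall>t. (F has_real_derivative sin (k * t\<^sup>2 - 0)) (at t)" for F
    proof -
      have "k * F a < k * F 0" "k * F 0 < k * F b"
        using left[of 0 a F] right[of 0 b F] that 3 by auto
      then show ?thesis by auto
    qed
    then show ?thesis by blast
  qed
qed

lemma inner_direction: "direction a \<bullet> direction b = cos (a - b)"
  by (simp add: inner_plane cos_diff)

text \<open>Completing the square moves the inflection point to parameter 0. A suitable projection
  then turns a double point into two equal values of a primitive of
  \<open>sin (c2 * t\<^sup>2 - c)\<close>, while a line is projected onto its own direction.\<close>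

lemma inj_family_curve:
  assumes "c2 \<noteq> 0 \<or> c1 = 0"
  shows "inj (family_curve c1 c2 V1 V2 \<theta>)"
proof -
  let ?\<gamma> = "family_curve c1 c2 V1 V2 \<theta>"
  have ne: "?\<gamma> a \<noteq> ?\<gamma> b" if "a < b" for a b
  proof
    assume eq: "?\<gamma> a = ?\<gamma> b"
    \<comment> \<open>The vertex of the quadratic phase, where the curvature vanishes; for
      \<open>c2 = 0\<close> division by zero makes it 0.\<close>
    define m where "m = - c1 / (2 * c2)"
    have D: "((\<lambda>t. ?\<gamma> (t + m) \<bullet> direction \<beta>) has_real_derivative
        cos (c1 * (t + m) + c2 * (t + m)\<^sup>2 + \<theta> - \<beta>)) (at t)" for t \<beta>
    proof -
      have "((\<lambda>t. ?\<gamma> (t + m)) has_vector_derivative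
          direction (c1 * (t + m) + c2 * (t + m)\<^sup>2 + \<theta>)) (at t)"
        by (rule has_vector_derivative_shift[OF has_vector_derivative_family_curve])
      from bounded_linear.has_vector_derivative[OF bounded_linear_inner_left this, of "direction \<beta>"]
      show ?thesis
        by (simp add: has_real_derivative_iff_has_vector_derivative inner_direction)
    qed
    show False
    proof (cases "c2 = 0")
      case True
      with assms have "m = 0" "c1 = 0" by (auto simp: m_def)
      with True D[of \<theta>] have D1: "((\<lambda>t. ?\<gamma> t \<bullet> direction \<theta>) has_real_derivative 1) (at t)" for t
        by simp
      have "?\<gamma> a \<bullet> direction \<theta> < ?\<gamma> b \<bullet> direction \<theta>"
        by (rule DERIV_pos_imp_increasing[OF \<open>a < b\<close>]) (use D1 zero_less_one in blast)
      with eq show False by simp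
    next
      case False
      obtain c where c: "\<forall>F. (\<forall>t. (F has_real_derivative sin (c2 * t\<^sup>2 - c)) (at t)) \<longrightarrow>
          F (a - m) \<noteq> F (b - m)"
        using sin_square_primitive_separates[OF False diff_strict_right_mono[OF \<open>a < b\<close>]] by blast
      have "c1 * (t + m) + c2 * (t + m)\<^sup>2 = c2 * t\<^sup>2 - c2 * m\<^sup>2" for t
        using False by (simp add: m_def field_simps power2_eq_square)
      \<comment> \<open>The angle of projection cancels \<open>\<theta>\<close> and
        \<open>c2 * m\<^sup>2\<close>, inserts the shift \<open>c\<close>, and its
        \<open>pi / 2\<close> changes the cosine into a sine.\<close>
      then have "c1 * (t + m) + c2 * (t + m)\<^sup>2 + \<theta> - (\<theta> - c2 * m\<^sup>2 + c + pi / 2) =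
          (c2 * t\<^sup>2 - c) - pi / 2" for t
        by simp
      moreover have "cos (x - pi / 2) = sin x" for x :: real
        by (simp add: cos_diff)
      ultimately have "cos (c1 * (t + m) + c2 * (t + m)\<^sup>2 + \<theta> - (\<theta> - c2 * m\<^sup>2 + c + pi / 2)) =
          sin (c2 * t\<^sup>2 - c)" for t
        by metis
      with D[of "\<theta> - c2 * m\<^sup>2 + c + pi / 2"]
      have "((\<lambda>t. ?\<gamma> (t + m) \<bullet> direction (\<theta> - c2 * m\<^sup>2 + c + pi / 2)) has_real_derivative
          sin (c2 * t\<^sup>2 - c)) (at t)" for t
        by simp
      with c have "?\<gamma> (a - m + m) \<bullet> direction (\<theta> - c2 * m\<^sup>2 + c + pi / 2) \<noteq>
          ?\<gamma> (b - m + m) \<bullet> direction (\<theta> - c2 * m\<^sup>2 + c + pi / 2)"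
        by blast
      with eq show False by simp
    qed
  qed
  show ?thesis
    by (rule injI) (metis ne linorder_less_linear)
qed

lemma open_or_closed_family_curve:
  "open_curve (family_curve c1 c2 V1 V2 \<theta>) \<or> closed_curve (family_curve c1 c2 V1 V2 \<theta>)"
  using closed_curve_family_curve inj_family_curve
    open_curve_if_injective[OF smooth_regular_family_curve, of c1 c2 V1 V2 \<theta>]
  by (cases "c2 = 0 \<and> c1 \<noteq> 0") (auto simp: vector_derivative_family_curve)

section \<open>Stationary curves\<close>

lemma smooth_arc_deriv:
  assumes "smooth_regular \<gamma>" "smooth f"
  shows "smooth (arc_deriv \<gamma> f)"
  unfolding arc_deriv_def using assms
  by (intro smooth_bilinear[OF bounded_bilinear_scaleR] smooth_inverse_norm smooth_vector_derivative)
    (auto simp: smooth_regular_def)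

lemma has_vector_derivative_arc_deriv:
  assumes "smooth_regular \<gamma>" "smooth f"
  shows "(f has_vector_derivative norm (vector_derivative \<gamma> (at u)) *\<^sub>R arc_deriv \<gamma> f u) (at u)"
  using smooth_has_vector_derivative[OF assms(2), of u] assms(1)
  by (simp add: arc_deriv_def smooth_regular_def)

section \<open>Arc length as a reparametrisation of the line\<close>

lemma reparametrisation_arc_length:
  assumes reg: "smooth_regular \<gamma>" and surj: "range (arc_length \<gamma>) = UNIV"
  shows "reparametrisation (arc_length \<gamma>)"
proof -
  note D = has_vector_derivative_arc_length[OF reg]
  have pos: "norm (vector_derivative \<gamma> (at u)) > 0" for u
    using reg by (simp add: smooth_regular_def)
  have "arc_length \<gamma> a < arc_length \<gamma> b" if "a < b" for a b
    using that
  proof (rule DERIV_pos_imp_increasing)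
    fix x show "\<exists>y. (arc_length \<gamma> has_real_derivative y) (at x) \<and> y > 0"
      using D pos unfolding has_real_derivative_iff_has_vector_derivative by blast
  qed
  then have "inj (arc_length \<gamma>)"
    by (intro injI) (metis less_irrefl linorder_less_linear)
  moreover have "smooth (\<lambda>u. norm (vector_derivative \<gamma> (at u)))"
    using reg by (intro smooth_norm smooth_vector_derivative) (auto simp: smooth_regular_def)
  with D have "smooth (arc_length \<gamma>)"
    by (rule smooth_from_derivative)
  moreover have "vector_derivative (arc_length \<gamma>) (at u) \<noteq> 0" for u
    using pos[of u] vector_derivative_at[OF D] by simp
  ultimately show ?thesis
    using surj by (simp add: reparametrisation_def bij_def)
qed

text \<open>The speed is periodic, so each period adds the same positive length. Arc length is
  therefore unbounded in both directions, and the intermediate value theorem applies.\<close>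

lemma surj_arc_length_closed_curve:
  assumes "closed_curve \<gamma>"
  shows "range (arc_length \<gamma>) = UNIV"
proof -
  obtain P where "P > 0" and per: "\<And>u. \<gamma> (u + P) = \<gamma> u" and reg: "smooth_regular \<gamma>"
    using assms by (auto simp: closed_curve_def)
  note D = has_vector_derivative_arc_length[OF reg]
  let ?L = "arc_length \<gamma>"
  have pos: "norm (vector_derivative \<gamma> (at u)) > 0" for u
    using reg by (simp add: smooth_regular_def)
  have "vector_derivative \<gamma> (at (u + P)) = vector_derivative \<gamma> (at u)" for u
    using has_vector_derivative_shift[OF smooth_has_vector_derivative[of \<gamma> "u + P"]] reg
    by (simp add: per smooth_regular_def vector_derivative_at)
  then have "((\<lambda>u. ?L (u + P) - ?L u) has_vector_derivative 0) (at u)" for u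
    using has_vector_derivative_diff[OF has_vector_derivative_shift[OF D[of "u + P"]] D[of u]] by simp
  then have step: "?L (u + P) = ?L u + ?L P" for u
    using constant_if_derivative_zero[of "\<lambda>u. ?L (u + P) - ?L u" u 0] by (simp add: algebra_simps)
  have "?L 0 < ?L P"
    using \<open>P > 0\<close>
  proof (rule DERIV_pos_imp_increasing)
    fix x show "\<exists>y. (?L has_real_derivative y) (at x) \<and> y > 0"
      using D pos unfolding has_real_derivative_iff_has_vector_derivative by blast
  qed
  then have LP: "?L P > 0" by simp
  have mult: "?L (real n * P) = real n * ?L P" "?L (- (real n * P)) = - (real n * ?L P)" for n
  proof (induction n)
    case (Suc n)
    { case 1 show ?case using step[of "real n * P"] Suc by (simp add: algebra_simps) }
    { case 2 show ?case using step[of "- (real (Suc n) * P)"] Suc by (simp add: algebra_simps) }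
  qed auto
  have "y \<in> range ?L" for y
  proof -
    obtain n where "\<bar>y\<bar> < real n * ?L P"
      using reals_Archimedean3[OF LP] by blast
    then have "?L (- (real n * P)) \<le> y" "y \<le> ?L (real n * P)"
      by (auto simp: mult)
    moreover have "continuous_on {- (real n * P)..real n * P} ?L"
      using D has_vector_derivative_continuous by (blast intro: continuous_at_imp_continuous_on)
    moreover have "- (real n * P) \<le> real n * P"
      using \<open>P > 0\<close> by simp
    ultimately show ?thesis
      using IVT'[of ?L "- (real n * P)" y "real n * P"] by blast
  qed
  then show ?thesis by blast
qed

section \<open>Reconstruction of a stationary curve from its curvature\<close>

text \<open>The coefficient of \<open>\<nu>\<close> along the turned tangent is differentiable with
  square 1. Differentiating the square shows that it is constant, so the choice of normal is one
  global sign.\<close>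

lemma unit_normal_field_rot90:
  assumes reg: "smooth_regular \<gamma>" and "unit_normal_field \<gamma> \<nu>"
  obtains e where "\<And>u. \<nu> u = e *\<^sub>R rot90 (arc_deriv \<gamma> \<gamma> u)"
proof -
  define T where "T = arc_deriv \<gamma> \<gamma>"
  have T: "norm (T u) = 1" for u
    using reg by (simp add: T_def arc_deriv_def smooth_regular_def)
  have "smooth T"
    using reg smooth_arc_deriv unfolding T_def smooth_regular_def by blast
  have \<nu>: "smooth \<nu>" "norm (\<nu> u) = 1" "\<nu> u \<bullet> T u = 0" for u
    using assms(2) by (auto simp: unit_normal_field_def T_def arc_deriv_def)
  define e where "e u = \<nu> u \<bullet> rot90 (T u)" for u
  have e: "\<nu> u = e u *\<^sub>R rot90 (T u)" for u
    unfolding e_def by (rule orthogonal_to_unit_vector[OF T \<nu>(3)])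
  have rot: "norm (rot90 (T u)) = 1" for u
    using T[of u] by (simp add: norm_eq_1 inner_plane algebra_simps)
  have "e u * e u = 1" for u
    using arg_cong[OF e[of u], of norm] \<nu>(2)[of u] rot[of u] abs_mult_self_eq[of "e u"] by simp
  have "(e has_vector_derivative 0) (at u)" for u
  proof -
    obtain e' where e': "(e has_real_derivative e') (at u)"
      using bounded_bilinear.has_vector_derivative[OF bounded_bilinear_inner
          smooth_has_vector_derivative[OF \<nu>(1)]
          bounded_linear.has_vector_derivative[OF bounded_linear_rot90
            smooth_has_vector_derivative[OF \<open>smooth T\<close>]], of u]
      unfolding e_def has_real_derivative_iff_has_vector_derivative by blast
    then have "((\<lambda>u. e u * e u) has_real_derivative e' * e u + e' * e u) (at u)"
      using DERIV_mult by blast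
    then have "e' * e u + e' * e u = 0"
      unfolding \<open>\<And>u. e u * e u = 1\<close> using DERIV_const DERIV_unique by blast
    with \<open>e u * e u = 1\<close> have "e' = 0" by auto
    with e' show ?thesis
      by (simp add: has_real_derivative_iff_has_vector_derivative)
  qed
  then have "e u = e 0" for u
    by (rule constant_if_derivative_zero)
  with e show ?thesis
    using that unfolding T_def by metis
qed

text \<open>The work stays in the given parameter: derivatives carry the speed \<open>v\<close> as a
  factor, and arc length enters as the function \<open>L\<close>.\<close>

lemma stationary_imp_family_curve:
  assumes "stationary \<gamma>"
  obtains c1 c2 V1 V2 \<theta> where "\<gamma> = family_curve c1 c2 V1 V2 \<theta> \<circ> arc_length \<gamma>"
proof -
  obtain \<nu> where reg: "smooth_regular \<gamma>" and \<nu>: "unit_normal_field \<gamma> \<nu>"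
    and stat: "\<And>u. arc_deriv \<gamma> (arc_deriv \<gamma> (curvature \<gamma> \<nu>)) u = 0"
    using assms by (auto simp: stationary_def)
  obtain e where e: "\<And>u. \<nu> u = e *\<^sub>R rot90 (arc_deriv \<gamma> \<gamma> u)"
    using unit_normal_field_rot90[OF reg \<nu>] by blast
  define L where "L = arc_length \<gamma>"
  define v where "v u = norm (vector_derivative \<gamma> (at u))" for u
  define T where "T = arc_deriv \<gamma> \<gamma>"
  define \<kappa> where "\<kappa> = curvature \<gamma> \<nu>"
  have "smooth \<gamma>" using reg by (simp add: smooth_regular_def)
  have "smooth T" unfolding T_def by (intro smooth_arc_deriv reg \<open>smooth \<gamma>\<close>)
  have T: "norm (T u) = 1" for u
    using reg by (simp add: T_def arc_deriv_def smooth_regular_def)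
  have DL: "(L has_vector_derivative v u) (at u)" for u
    unfolding L_def v_def by (rule has_vector_derivative_arc_length[OF reg])
  have D: "(f has_vector_derivative v u *\<^sub>R arc_deriv \<gamma> f u) (at u)" if "smooth f"
    for f :: "real \<Rightarrow> 'b::real_normed_vector" and u
    unfolding v_def by (rule has_vector_derivative_arc_deriv[OF reg that])

  have "smooth \<kappa>"
    unfolding \<kappa>_def curvature_def using \<nu> reg \<open>smooth \<gamma>\<close>
    by (intro smooth_bilinear[OF bounded_bilinear_inner] smooth_arc_deriv)
      (auto simp: unit_normal_field_def)
  have "(arc_deriv \<gamma> \<kappa> has_vector_derivative 0) (at u)" for u
    using D[OF smooth_arc_deriv[OF reg \<open>smooth \<kappa>\<close>], of u] by (simp add: stat \<kappa>_def)
  then have A: "arc_deriv \<gamma> \<kappa> u = arc_deriv \<gamma> \<kappa> 0" for u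
    by (rule constant_if_derivative_zero)
  define A where "A = arc_deriv \<gamma> \<kappa> 0"
  \<comment> \<open>By stationarity \<open>\<kappa>\<close> has constant slope \<open>A\<close> in
    arc length, so subtracting \<open>A * L\<close> leaves a constant.\<close>
  have "((\<lambda>u. \<kappa> u - A *\<^sub>R L u) has_vector_derivative v u *\<^sub>R A - A *\<^sub>R v u) (at u)" for u
    using D[OF \<open>smooth \<kappa>\<close>, of u] unfolding A[of u] A_def[symmetric]
    by (intro has_vector_derivative_diff DL
        bounded_linear.has_vector_derivative[OF bounded_linear_scaleR_right])
  then have \<kappa>: "\<kappa> u = \<kappa> 0 + A * L u" for u
    using constant_if_derivative_zero[of "\<lambda>u. \<kappa> u - A *\<^sub>R L u" u 0]
    by (simp add: mult.commute L_def algebra_simps)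

  obtain \<theta> where \<theta>: "T 0 = direction \<theta>"
    using unit_vector_direction[OF T] by blast
  \<comment> \<open>The tangent angle should have derivative \<open>e * \<kappa>\<close> in arc
    length; integrating \<open>e * (\<kappa> 0 + A * L)\<close> yields these coefficients, the half
    coming from the square.\<close>
  define c1 where "c1 = e * \<kappa> 0"
  define c2 where "c2 = e * A / 2"
  define \<phi> where "\<phi> u = c1 * L u + c2 * (L u)\<^sup>2 + \<theta>" for u
  have D\<phi>: "(\<phi> has_vector_derivative v u * (e * \<kappa> u)) (at u)" for u
  proof -
    have "(\<phi> has_vector_derivative v u *\<^sub>R (c1 + 2 * c2 * L u)) (at u)"
      unfolding \<phi>_def
      using vector_diff_chain_at[OF DL has_vector_derivative_phase[of c1 c2 \<theta>]] by (simp add: o_def)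
    then show ?thesis
      by (simp add: \<kappa>[of u] c1_def c2_def algebra_simps)
  qed
  have DT: "(T has_vector_derivative (v u * (e * \<kappa> u)) *\<^sub>R rot90 (T u)) (at u)" for u
  proof -
    let ?T' = "arc_deriv \<gamma> T u"
    \<comment> \<open>Differentiating \<open>T \<bullet> T = 1\<close> shows that the derivative of
      \<open>T\<close> is a multiple of the turned tangent.\<close>
    have "((\<lambda>u. T u \<bullet> T u) has_vector_derivative T u \<bullet> (v u *\<^sub>R ?T') + (v u *\<^sub>R ?T') \<bullet> T u) (at u)"
      by (intro bounded_bilinear.has_vector_derivative[OF bounded_bilinear_inner] D \<open>smooth T\<close>)
    moreover have "(\<lambda>u. T u \<bullet> T u) = (\<lambda>u. 1)"
      using T by (simp add: norm_eq_1)
    ultimately have "T u \<bullet> (v u *\<^sub>R ?T') + (v u *\<^sub>R ?T') \<bullet> T u = 0"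
      using vector_derivative_unique_at[OF _ has_vector_derivative_const] by metis
    moreover have "v u \<noteq> 0"
      using reg by (simp add: v_def smooth_regular_def)
    ultimately have "?T' \<bullet> T u = 0"
      by (simp add: inner_commute)
    then have T': "?T' = (?T' \<bullet> rot90 (T u)) *\<^sub>R rot90 (T u)"
      by (rule orthogonal_to_unit_vector[OF T])
    have "norm (\<nu> u) = 1" and "norm (rot90 (T u)) = 1"
      using \<nu> T[of u] by (auto simp: unit_normal_field_def norm_eq_1 inner_plane algebra_simps)
    then have "\<bar>e\<bar> = 1"
      by (simp add: e T_def)
    then have "e * e = 1" by (metis abs_mult_self_eq mult_1)
    \<comment> \<open>The normal carries the sign \<open>e\<close>; since \<open>e * e = 1\<close>,
      this can be solved for the turning rate of the tangent.\<close>
    have "\<kappa> u = e * (?T' \<bullet> rot90 (T u))"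
      by (simp add: \<kappa>_def curvature_def e T_def)
    with \<open>e * e = 1\<close> have "?T' \<bullet> rot90 (T u) = e * \<kappa> u"
      by (simp flip: mult.assoc)
    with T' have "v u *\<^sub>R ?T' = (v u * (e * \<kappa> u)) *\<^sub>R rot90 (T u)"
      by simp
    with D[OF \<open>smooth T\<close>, of u] show ?thesis by simp
  qed

  \<comment> \<open>\<open>T\<close> and \<open>direction \<circ> \<phi>\<close> solve the same linear equation \<open>X' = \<phi>' *\<^sub>R rot90 X\<close>,
    which preserves the norm of a solution.\<close>
  define W where "W u = T u - direction (\<phi> u)" for u
  have DW: "(W has_vector_derivative (v u * (e * \<kappa> u)) *\<^sub>R rot90 (W u)) (at u)" for u
    unfolding W_def rot90_diff scaleR_diff_right
    by (intro has_vector_derivative_diff DT has_vector_derivative_direction D\<phi>)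
  have "((\<lambda>u. W u \<bullet> W u) has_vector_derivative 0) (at u)" for u
    using bounded_bilinear.has_vector_derivative[OF bounded_bilinear_inner DW DW, of u]
    by (simp add: inner_commute[of "W u"])
  from constant_if_derivative_zero[OF this, of u 0 for u]
  have "W u \<bullet> W u = W 0 \<bullet> W 0" for u .
  moreover have "W 0 = 0"
    by (simp add: W_def \<theta> \<phi>_def L_def)
  ultimately have T\<phi>: "T u = direction (\<phi> u)" for u
    by (metis W_def eq_iff_diff_eq_0 inner_eq_zero_iff)

  \<comment> \<open>Arc length is 0 at parameter 0, so the translation is the initial point.\<close>
  define V1 where "V1 = \<gamma> 0 $ 1"
  define V2 where "V2 = \<gamma> 0 $ 2"
  let ?\<beta> = "family_curve c1 c2 V1 V2 \<theta>"
  have "((\<lambda>u. \<gamma> u - ?\<beta> (L u)) has_vector_derivative 0) (at u)" for u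
  proof -
    have "((?\<beta> \<circ> L) has_vector_derivative v u *\<^sub>R T u) (at u)"
      unfolding T\<phi> \<phi>_def
      by (rule vector_diff_chain_at[OF DL has_vector_derivative_family_curve])
    from has_vector_derivative_diff[OF D[OF \<open>smooth \<gamma>\<close>] this] show ?thesis
      by (simp add: T_def o_def)
  qed
  then have "\<gamma> u = ?\<beta> (L u)" for u
    using constant_if_derivative_zero[of "\<lambda>u. \<gamma> u - ?\<beta> (L u)" u 0]
    by (simp add: L_def V1_def V2_def vec_eq_iff forall_2)
  then show ?thesis
    using that unfolding L_def by fastforce
qed

theorem mainTheorem3:
  "(\<forall>\<gamma>. (open_curve \<gamma> \<or> closed_curve \<gamma>) \<and> stationary \<gamma> \<longrightarrow>
      (\<exists>c1 c2 V1 V2 \<theta> \<phi>. reparametrisation \<phi> \<and> \<gamma> = family_curve c1 c2 V1 V2 \<theta> \<circ> \<phi>)) \<and>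
   (\<forall>c1 c2 V1 V2 \<theta>.
      (open_curve (family_curve c1 c2 V1 V2 \<theta>) \<or> closed_curve (family_curve c1 c2 V1 V2 \<theta>)) \<and>
      stationary (family_curve c1 c2 V1 V2 \<theta>) \<and>
      (\<forall>s. norm (vector_derivative (family_curve c1 c2 V1 V2 \<theta>) (at s)) = 1))"
proof (intro conjI allI impI)
  fix \<gamma> assume *: "(open_curve \<gamma> \<or> closed_curve \<gamma>) \<and> stationary \<gamma>"
  \<comment> \<open>An open curve has infinite length both ways by definition, a closed one by
    periodicity.\<close>
  then have "range (arc_length \<gamma>) = UNIV"
    using surj_arc_length_closed_curve by (auto simp: open_curve_def)
  moreover have "smooth_regular \<gamma>"
    using * by (simp add: stationary_def)
  ultimately have "reparametrisation (arc_length \<gamma>)"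
    by (intro reparametrisation_arc_length)
  with * show "\<exists>c1 c2 V1 V2 \<theta> \<phi>. reparametrisation \<phi> \<and> \<gamma> = family_curve c1 c2 V1 V2 \<theta> \<circ> \<phi>"
    using stationary_imp_family_curve by metis
qed (simp_all add: open_or_closed_family_curve stationary_family_curve vector_derivative_family_curve)

end
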